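(* Let $K$ be a field, let $I \subset R = K[x,y,z]$ be a monomial ideal, let $d \geq 1$ be an integer, and let $T = T_d(I)$ be the associated triangular region. Then any two of the following conditions imply the third: (i) $T$ is perfectly-punctured; (ii) $T$ has no over-punctured monomial subregions; (iii) $T$ is tileable.
   Context: Triangular regions. $R = K[x,y,z]$ is standard graded. For an integer $d \geq 1$, $\mathcal{T}_d$ is an equilateral triangle of side length $d$ subdivided into unit triangles: $\binom{d+1}{2}$ upward-pointing ones, labeled bijectively by the monomials of degree $d-1$, and $\binom{d}{2}$ downward-pointing ones, labeled bijectively by the monomials of degree $d-2$, with $x^{d-1}$ at the top, $y^{d-1}$ at the bottom-left, $z^{d-1}$ at the bottom-right, so that a downward-pointing triangle labeled $m$ shares an edge precisely with the upward-pointing triangles labeled $xm, ym, zm$. For a monomial ideal $I$, $T_d(I)$ is the set of unit triangles of $\mathcal{T}_d$ whose labels are not in $I$. Tileability. A lozenge is a union of two unit triangles sharing an edge (so one is upward-pointing and one is downward-pointing). A set of unit triangles is tileable if it is empty or if it can be partitioned into lozenges. Punctures. Each minimal monomial generator $g$ of $I$ of degree less than $d$ gives a puncture of side length $d - \deg g$, namely the upward-pointing triangle formed by all unit triangles of $\mathcal{T}_d$ whose label is divisible by $g$. The over-puncturing coefficient of $I$ in degree $d$ is $\mathfrak{o}_d(I) = \sum_g (d - \deg g) - d$, the sum being over the minimal generators $g$ of $I$ with $\deg g < d$. For $T = T_d(I)$ let $J(T)$ be the unique largest ideal generated by monomials of degree at most $d-1$ such that $T = T_d(J(T))$; the punctures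 of $T$ are those of $J(T)$, and $\mathfrak{o}_d(T) := \mathfrak{o}_d(J(T))$. $T$ is called under-punctured, perfectly-punctured, or over-punctured if $\mathfrak{o}_d(T)$ is $<0$, $=0$, or $>0$, respectively. Monomial subregions. For a monomial $n$ of degree $e < d$, the monomial subregion of $T = T_d(I)$ associated to $n$ consists of the unit triangles of $T$ whose label is divisible by $n$. Dividing labels by $n$ identifies it with the triangular region $T_{d-e}(I : n) \subset \mathcal{T}_{d-e}$, and it is called over-punctured if $\mathfrak{o}_{d-e}(T_{d-e}(I:n)) > 0$. *)

theory Defs
  imports Complex_Main "HOL-Library.Poly_Mapping" "HOL-Library.Disjoint_Sets"
begin

section \<open>The polynomial ring in three variables over a field\<close>

datatype var = VarX | VarY | VarZ

text \<open>A monomial is represented by its exponent vector, so multiplication of monomials is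
  addition. The convolution product of \<^theory>\<open>HOL-Library.Poly_Mapping\<close> makes \<open>'k poly3\<close> the
  ring \<open>K[x,y,z]\<close>.\<close>

type_synonym mon = "var \<Rightarrow>\<^sub>0 nat"
type_synonym 'k poly3 = "mon \<Rightarrow>\<^sub>0 'k"

definition mdeg :: "mon \<Rightarrow> nat" where
  "mdeg m = Poly_Mapping.lookup m VarX + Poly_Mapping.lookup m VarY + Poly_Mapping.lookup m VarZ"

definition mdvd :: "mon \<Rightarrow> mon \<Rightarrow> bool" (infix \<open>mdvd\<close> 50) where
  "m mdvd n \<longleftrightarrow> (\<exists>k. n = m + k)"

abbreviation mvar :: "var \<Rightarrow> mon" where
  "mvar v \<equiv> Poly_Mapping.single v 1"

abbreviation monomial :: "mon \<Rightarrow> 'k::field poly3" where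
  "monomial m \<equiv> Poly_Mapping.single m 1"

text \<open>Ideals of a commutative ring are the submodules of the ring over itself;
  \<open>ring_ideal.span\<close> is the ideal generated by a set.\<close>

interpretation ring_ideal: module "(*) :: 'a::comm_ring_1 \<Rightarrow> 'a \<Rightarrow> 'a"
  by standard (simp_all add: algebra_simps)

definition mon_span :: "mon set \<Rightarrow> 'k::field poly3 set" where
  "mon_span M = ring_ideal.span (monomial ` M)"

definition monomial_ideal :: "'k::field poly3 set \<Rightarrow> bool" where
  "monomial_ideal I \<longleftrightarrow> (\<exists>M. I = mon_span M)"

definition colon :: "'k::field poly3 set \<Rightarrow> mon \<Rightarrow> 'k poly3 set" where
  "colon I n = {f. f * monomial n \<in> I}"

definition min_gens :: "'k::field poly3 set \<Rightarrow> mon set" where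
  "min_gens I = {g. monomial g \<in> I \<and> (\<forall>h. monomial h \<in> I \<and> h mdvd g \<longrightarrow> h = g)}"


section \<open>Triangular regions and tilings\<close>

text \<open>A unit triangle of the subdivided triangle of side length \<open>d\<close> is given by its orientation and
  its label. Degrees are stated without subtraction, since for \<open>d = 1\<close> there is no downward-pointing
  triangle.\<close>

datatype triangle = Up (label: mon) | Down (label: mon)

definition triangles :: "nat \<Rightarrow> triangle set" where
  "triangles d = Up ` {m. mdeg m + 1 = d} \<union> Down ` {m. mdeg m + 2 = d}"

definition region :: "nat \<Rightarrow> 'k::field poly3 set \<Rightarrow> triangle set" where
  "region d I = {t \<in> triangles d. monomial (label t) \<notin> I}"

text \<open>The downward-pointing triangle labeled \<open>m\<close> shares an edge precisely with the upward-pointing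
  triangles labeled \<open>x m\<close>, \<open>y m\<close>, \<open>z m\<close>.\<close>

definition lozenge :: "triangle set \<Rightarrow> bool" where
  "lozenge L \<longleftrightarrow> (\<exists>m v. L = {Down m, Up (mvar v + m)})"

definition tileable :: "triangle set \<Rightarrow> bool" where
  "tileable T \<longleftrightarrow> T = {} \<or> (\<exists>P. partition_on T P \<and> (\<forall>L\<in>P. lozenge L))"


section \<open>Punctures\<close>

definition ideal_coeff :: "nat \<Rightarrow> 'k::field poly3 set \<Rightarrow> int" where
  "ideal_coeff d I = (\<Sum>g\<in>{g \<in> min_gens I. mdeg g < d}. int d - int (mdeg g)) - int d"

text \<open>The ideal \<open>J(T)\<close>; see \<open>largest_ideal_region\<close> below for its existence.\<close>

definition ideal_for :: "nat \<Rightarrow> triangle set \<Rightarrow> 'k::field poly3 set \<Rightarrow> bool" where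
  "ideal_for d T J \<longleftrightarrow> (\<exists>M. (\<forall>m\<in>M. mdeg m \<le> d - 1) \<and> J = mon_span M) \<and> region d J = T"

definition largest_ideal :: "nat \<Rightarrow> triangle set \<Rightarrow> 'k::field poly3 set" where
  "largest_ideal d T = (GREATEST J. ideal_for d T J)"

text \<open>The type argument is the field \<open>K\<close>, which a set of unit triangles does not determine.\<close>

definition region_coeff :: "'k::field itself \<Rightarrow> nat \<Rightarrow> triangle set \<Rightarrow> int" where
  "region_coeff _ d T = ideal_coeff d (largest_ideal d T :: 'k poly3 set)"

definition perfectly_punctured :: "'k::field itself \<Rightarrow> nat \<Rightarrow> triangle set \<Rightarrow> bool" where
  "perfectly_punctured K d T \<longleftrightarrow> region_coeff K d T = 0"

definition over_punctured :: "'k::field itself \<Rightarrow> nat \<Rightarrow> triangle set \<Rightarrow> bool" where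
  "over_punctured K d T \<longleftrightarrow> region_coeff K d T > 0"

definition monomial_subregion :: "mon \<Rightarrow> triangle set \<Rightarrow> triangle set" where
  "monomial_subregion n T = {t \<in> T. n mdvd label t}"

text \<open>Whether a monomial subregion is over-punctured is decided after dividing its labels by \<open>n\<close>,
  which turns it into the region of the colon ideal; see \<open>monomial_subregion_region\<close> below.\<close>

definition over_punctured_subregion :: "nat \<Rightarrow> 'k::field poly3 set \<Rightarrow> mon \<Rightarrow> bool" where
  "over_punctured_subregion d I n \<longleftrightarrow>
    over_punctured TYPE('k) (d - mdeg n) (region (d - mdeg n) (colon I n))"


section \<open>Consistency of the definitions\<close>

lemma mdeg_add [simp]: "mdeg (m + n) = mdeg m + mdeg n"
  by (simp add: mdeg_def lookup_add)

lemma finite_mdeg_less: "finite {m. mdeg m < d}"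
proof -
  let ?f = "\<lambda>m::mon. (Poly_Mapping.lookup m VarX, Poly_Mapping.lookup m VarY, Poly_Mapping.lookup m VarZ)"
  have "inj ?f"
  proof (rule injI, rule poly_mapping_eqI)
    fix m n :: mon and v
    assume "?f m = ?f n"
    then show "Poly_Mapping.lookup m v = Poly_Mapping.lookup n v" by (cases v) simp_all
  qed
  moreover have "?f ` {m. mdeg m < d} \<subseteq> {..d} \<times> {..d} \<times> {..d}"
    by (auto simp: mdeg_def)
  ultimately show ?thesis
    by (meson finite_SigmaI finite_atMost finite_imageD finite_subset inj_on_subset subset_UNIV)
qed

lemma monomial_in_mon_span:
  "(monomial m :: 'k::field poly3) \<in> mon_span M \<longleftrightarrow> (\<exists>n\<in>M. n mdvd m)"
proof
  let ?S = "{f :: 'k poly3. \<forall>m\<in>Poly_Mapping.keys f. \<exists>n\<in>M. n mdvd m}"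
  have "ring_ideal.subspace ?S"
  proof (rule ring_ideal.subspaceI)
    fix f g :: "'k poly3" assume "f \<in> ?S" "g \<in> ?S"
    then show "f + g \<in> ?S" using keys_add[of f g] by blast
  next
    fix c f :: "'k poly3" assume f: "f \<in> ?S"
    have "\<exists>n\<in>M. n mdvd m" if m: "m \<in> Poly_Mapping.keys (c * f)" for m
    proof -
      obtain a b where ab: "b \<in> Poly_Mapping.keys f" "m = a + b"
        using m keys_mult[of c f] by blast
      with f obtain n k where "n \<in> M" "b = n + k" unfolding mdvd_def by blast
      with ab have "m = n + (a + k)" by (simp add: ac_simps)
      with \<open>n \<in> M\<close> show ?thesis unfolding mdvd_def by blast
    qed
    then show "c * f \<in> ?S" by simp
  qed simp
  moreover have "monomial ` M \<subseteq> ?S"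
    by (force simp: mdvd_def intro: exI[of _ 0])
  ultimately have "mon_span M \<subseteq> ?S"
    unfolding mon_span_def by (rule ring_ideal.span_minimal[rotated])
  moreover assume "(monomial m :: 'k poly3) \<in> mon_span M"
  ultimately show "\<exists>n\<in>M. n mdvd m" by auto
next
  assume "\<exists>n\<in>M. n mdvd m"
  then obtain n k where n: "n \<in> M" "m = n + k" unfolding mdvd_def by blast
  then have "(monomial m :: 'k poly3) = monomial k * monomial n"
    by (simp add: mult_single ac_simps)
  with n show "(monomial m :: 'k poly3) \<in> mon_span M"
    unfolding mon_span_def by (metis imageI ring_ideal.span_base ring_ideal.span_scale)
qed

primrec mult_label :: "mon \<Rightarrow> triangle \<Rightarrow> triangle" where
  "mult_label n (Up m) = Up (n + m)"
| "mult_label n (Down m) = Down (n + m)"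

lemma monomial_subregion_region:
  assumes "mdeg n < d"
  shows "bij_betw (mult_label n) (region (d - mdeg n) (colon I n)) (monomial_subregion n (region d I))"
proof -
  have "inj (mult_label n)"
  proof (rule injI)
    fix s t assume "mult_label n s = mult_label n t"
    then show "s = t" by (cases s; cases t) simp_all
  qed
  moreover have "t \<in> mult_label n ` region (d - mdeg n) (colon I n)"
    if t: "t \<in> monomial_subregion n (region d I)" for t
  proof (cases t)
    case (Up m)
    with t obtain k where "m = n + k" by (auto simp: monomial_subregion_def mdvd_def)
    with t Up have "t = mult_label n (Up k)" "Up k \<in> region (d - mdeg n) (colon I n)"

      by (auto simp: monomial_subregion_def region_def triangles_def colon_def mult_single
          add.commute[of _ n])
    then show ?thesis by blast
  next
    case (Down m)
    with t obtain k where "m = n + k" by (auto simp: monomial_subregion_def mdvd_def)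
    with t Down have "t = mult_label n (Down k)" "Down k \<in> region (d - mdeg n) (colon I n)"

      by (auto simp: monomial_subregion_def region_def triangles_def colon_def mult_single
          add.commute[of _ n])
    then show ?thesis by blast
  qed
  moreover have "mult_label n t \<in> monomial_subregion n (region d I)"
    if "t \<in> region (d - mdeg n) (colon I n)" for t
    using that assms
    by (auto simp: monomial_subregion_def region_def triangles_def colon_def mult_single mdvd_def
        add.commute[of _ n])
  ultimately show ?thesis
    unfolding bij_betw_def using inj_on_subset by blast
qed

lemma largest_ideal_region:
  fixes I :: "'k::field poly3 set"
  assumes "monomial_ideal I" "d \<ge> 1"
  shows "ideal_for d (region d I) (largest_ideal d (region d I) :: 'k poly3 set)"
    and "ideal_for d (region d I) (J :: 'k poly3 set) \<Longrightarrow> J \<subseteq> largest_ideal d (region d I)"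
proof -
  let ?T = "region d I"
  define G where
    "G = {m. \<exists>M. m \<in> M \<and> (\<forall>m\<in>M. mdeg m \<le> d - 1) \<and> region d (mon_span M :: 'k poly3 set) = ?T}"
  let ?J = "mon_span G :: 'k poly3 set"
  have in_region: "monomial (label t) \<in> L \<longleftrightarrow> t \<notin> region d L"
    if "t \<in> triangles d" for t and L :: "'k poly3 set"
    using that by (simp add: region_def)
  obtain N where N: "I = mon_span N" using assms(1) unfolding monomial_ideal_def by blast
  define M0 where "M0 = {m\<in>N. mdeg m \<le> d - 1}"
  have M0: "region d (mon_span M0 :: 'k poly3 set) = ?T"
  proof -
    have "(\<exists>n\<in>M0. n mdvd label t) \<longleftrightarrow> (\<exists>n\<in>N. n mdvd label t)" if t: "t \<in> triangles d" for t
    proof -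
      have "mdeg n \<le> d - 1" if "n mdvd label t" for n
        using that t by (auto simp: triangles_def mdvd_def)
      then show ?thesis by (auto simp: M0_def)
    qed
    then show ?thesis by (auto simp: region_def N monomial_in_mon_span)
  qed
  have reg: "region d ?J = ?T"
  proof -
    have "monomial (label t) \<in> ?J \<longleftrightarrow> monomial (label t) \<in> I" if t: "t \<in> triangles d" for t
    proof
      assume "monomial (label t) \<in> ?J"
      then obtain n where n: "n \<in> G" "n mdvd label t" unfolding monomial_in_mon_span by blast
      then obtain M where M: "n \<in> M" "region d (mon_span M :: 'k poly3 set) = ?T"
        unfolding G_def by blast
      with n have "monomial (label t) \<in> (mon_span M :: 'k poly3 set)"
        unfolding monomial_in_mon_span by blast
      with M t show "monomial (label t) \<in> I" by (simp add: in_region)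
    next
      assume "monomial (label t) \<in> I"
      with t M0 have "monomial (label t) \<in> (mon_span M0 :: 'k poly3 set)"
        by (simp add: in_region)
      then obtain n where n: "n \<in> M0" "n mdvd label t" unfolding monomial_in_mon_span by blast
      have "n \<in> G"
        unfolding G_def by (intro CollectI exI[of _ M0] conjI n(1) M0) (simp add: M0_def)
      with n show "monomial (label t) \<in> ?J" unfolding monomial_in_mon_span by blast
    qed
    then show ?thesis by (auto simp: region_def)
  qed
  have J: "ideal_for d ?T ?J"
    unfolding ideal_for_def by (intro conjI exI[of _ G] refl reg) (auto simp: G_def)
  have max: "J' \<subseteq> ?J" if J': "ideal_for d ?T J'" for J' :: "'k poly3 set"
  proof -
    obtain M where M: "\<forall>m\<in>M. mdeg m \<le> d - 1" "J' = mon_span M" "region d J' = ?T"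
      using J' unfolding ideal_for_def by blast
    then have "M \<subseteq> G" unfolding G_def by blast
    then show ?thesis unfolding M(2) mon_span_def by (intro ring_ideal.span_mono image_mono)
  qed
  have eq: "largest_ideal d ?T = ?J"
    unfolding largest_ideal_def by (rule Greatest_equality) (rule J, rule max)
  show "ideal_for d ?T (largest_ideal d ?T :: 'k poly3 set)"
    unfolding eq by (rule J)
  show "J \<subseteq> largest_ideal d ?T" if "ideal_for d ?T J"
    unfolding eq by (rule max[OF that])
qed

end

theory Submission
  imports Defs
begin

text \<open>
  The region is governed by the set \<open>A\<close> of monomials of \<open>J(T)\<close>, and the key quantity is the excess
  of \<open>A\<close>: the number of its monomials of degree \<open>d - 1\<close> minus that of degree \<open>d - 2\<close>, so that
  \<open>T\<close> is balanced exactly if the excess of \<open>A\<close> is \<open>d\<close>. The multiples of \<open>n\<close> form a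
  triangle of side \<open>d - deg n\<close> and have excess \<open>d - deg n\<close>. Excess is additive under union and
  intersection, and the excess of any upward closed set is at least the number of strips (level sets
  of one exponent) that it meets in degree \<open>d - 1\<close>; in particular it is nonnegative, and it vanishes
  only if there is nothing in degree \<open>d - 1\<close>. Consequently the excess of \<open>A\<close> is at most the sum of
  the side lengths of the punctures, with equality exactly if no two punctures overlap
  (\<open>excess_le_side_sum\<close>, \<open>excess_eq_side_sum_iff\<close>).

  Suppose \<open>T\<close> is tileable. Then it is balanced, so the sum of the side lengths is at least \<open>d\<close>.
  If no subregion is over-punctured, the sum is also at most \<open>d\<close>, hence equal. If instead \<open>T\<close> is
  perfectly-punctured, equality holds above and punctures do not overlap; this passes to subregions.
  In a tiling of \<open>T\<close> each downward triangle of a subregion is paired with an upward triangle of the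
  same subregion, which bounds the excess of \<open>A\<close> inside the subregion, and without overlaps that
  excess is the sum of the side lengths of the subregion's punctures.

  Conversely, suppose that \<open>T\<close> is perfectly-punctured and has no over-punctured subregion. Two
  punctures that overlap would over-puncture the subregion of their greatest common divisor, so there
  are none, and \<open>T\<close> is balanced. By Hall's theorem a tiling exists unless some set \<open>D\<close> of downward
  triangles has too few neighbours, in which case the set generated by \<open>D\<close> together with \<open>A\<close> has
  smaller excess than \<open>A\<close>. Replacing two overlapping generators by their greatest common divisor
  does not increase the excess (\<open>excess_gcd_merge\<close>), so the generators may be taken pairwise
  non-overlapping. Then both excesses are sums over the generated triangles, and in one of these
  triangles \<open>A\<close> has more excess than the triangle itself: that triangle is an over-punctured
  subregion (\<open>excess_minimal_if_no_over_punctured\<close>).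
\<close>

section \<open>Systems of distinct representatives\<close>

text \<open>Hall's theorem, by the induction of Halmos and Vaughan: a proper subset for which the condition
  is tight can be matched separately from its complement; if there is none, any choice for one element
  leaves the condition intact for the others.\<close>

lemma hall_marriage:
  fixes N :: "'a \<Rightarrow> 'b set"
  assumes "finite Y" and "\<And>y. y \<in> Y \<Longrightarrow> finite (N y)"
    and "\<And>D. D \<subseteq> Y \<Longrightarrow> card D \<le> card (\<Union>(N ` D))"
  shows "\<exists>\<sigma>. inj_on \<sigma> Y \<and> (\<forall>y\<in>Y. \<sigma> y \<in> N y)"
  using assms
proof (induction "card Y" arbitrary: Y N rule: less_induct)
  case less
  note fin = less.prems(1) and finN = less.prems(2) and hall = less.prems(3)
  have finU: "finite (\<Union>(N ` D))" if "D \<subseteq> Y" for D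
    using that fin finN finite_subset by blast
  show ?case
  proof (cases "\<exists>D. D \<subset> Y \<and> D \<noteq> {} \<and> card (\<Union>(N ` D)) = card D")
    case True
    then obtain D where D: "D \<subset> Y" "D \<noteq> {}" "card (\<Union>(N ` D)) = card D" by blast
    have finD: "finite D" using D(1) fin finite_subset by blast
    have "card D < card Y" using D(1) fin by (simp add: psubset_card_mono)
    moreover have "card E \<le> card (\<Union>(N ` E))" if "E \<subseteq> D" for E
      using hall that D(1) by blast
    ultimately obtain \<sigma> where \<sigma>: "inj_on \<sigma> D" "\<forall>y\<in>D. \<sigma> y \<in> N y"
      using less.hyps[of D N] finD finN D(1) by blast
    \<comment> \<open>As \<open>D\<close> is tight, removing its neighbours costs a set \<open>E\<close> outside \<open>D\<close> no more than
      what \<open>E \<union> D\<close> has to spare.\<close>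
    let ?N = "\<lambda>y. N y - \<Union>(N ` D)"
    have "card (Y - D) < card Y"
      using D fin finD by (intro psubset_card_mono) auto
    moreover have "card E \<le> card (\<Union>(?N ` E))" if E: "E \<subseteq> Y - D" for E
    proof -
      have "finite E" using E fin finite_subset by blast
      have "card E + card D = card (E \<union> D)"
        using E finD \<open>finite E\<close> by (intro card_Un_disjoint[symmetric]) auto
      also have "\<dots> \<le> card (\<Union>(N ` (E \<union> D)))"
        using E D(1) by (intro hall) auto
      also have "\<Union>(N ` (E \<union> D)) = \<Union>(?N ` E) \<union> \<Union>(N ` D)" by auto
      also have "card \<dots> \<le> card (\<Union>(?N ` E)) + card (\<Union>(N ` D))" by (rule card_Un_le)
      finally show ?thesis using D(3) by simp
    qed
    ultimately obtain \<tau> where \<tau>: "inj_on \<tau> (Y - D)" "\<forall>y\<in>Y-D. \<tau> y \<in> ?N y"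
      using less.hyps[of "Y - D" ?N] fin finN by (auto simp: finite_Diff)
    let ?\<rho> = "\<lambda>y. if y \<in> D then \<sigma> y else \<tau> y"
    have sep: "\<sigma> y \<noteq> \<tau> z" if "y \<in> D" "z \<in> Y - D" for y z
      using that \<sigma>(2) \<tau>(2) by force
    have "inj_on ?\<rho> Y"
    proof (rule inj_onI)
      fix y z assume yz: "y \<in> Y" "z \<in> Y" "?\<rho> y = ?\<rho> z"
      then show "y = z"
        using sep[of y z] sep[of z y] inj_onD[OF \<sigma>(1), of y z] inj_onD[OF \<tau>(1), of y z]
        by (auto split: if_splits)
    qed
    moreover have "\<forall>y\<in>Y. ?\<rho> y \<in> N y" using \<sigma>(2) \<tau>(2) by auto
    ultimately show ?thesis by blast
  next
    case False
    show ?thesis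
    proof (cases "Y = {}")
      case True then show ?thesis by simp
    next
      case nonempty: False
      then obtain y where y: "y \<in> Y" by blast
      with hall[of "{y}"] obtain x where x: "x \<in> N y" by fastforce
      let ?N = "\<lambda>z. N z - {x}"
      have "card (Y - {y}) < card Y" using fin y by (rule card_Diff1_less)
      moreover have "card E \<le> card (\<Union>(?N ` E))" if E: "E \<subseteq> Y - {y}" for E
      proof (cases "E = {}")
        case False
        have "E \<subset> Y" using E y by blast
        with False have "card (\<Union>(N ` E)) \<noteq> card E"
          using \<open>\<not> (\<exists>D. D \<subset> Y \<and> D \<noteq> {} \<and> card (\<Union>(N ` D)) = card D)\<close> by blast
        with hall[of E] \<open>E \<subset> Y\<close> have "card E + 1 \<le> card (\<Union>(N ` E))" by auto
        moreover have "\<Union>(?N ` E) = \<Union>(N ` E) - {x}" by auto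
        moreover have "card (\<Union>(N ` E)) - 1 \<le> card (\<Union>(N ` E) - {x})"
          by (simp add: card_Diff_singleton_if)
        ultimately show ?thesis by simp
      qed simp
      ultimately obtain \<tau> where \<tau>: "inj_on \<tau> (Y - {y})" "\<forall>z\<in>Y-{y}. \<tau> z \<in> ?N z"
        using less.hyps[of "Y - {y}" ?N] fin finN by (auto simp: finite_Diff)
      have "inj_on (\<tau>(y := x)) Y"
        using \<tau> by (auto simp: inj_on_def)
      moreover have "\<forall>z\<in>Y. (\<tau>(y := x)) z \<in> N z" using \<tau>(2) x by auto
      ultimately show ?thesis by blast
    qed
  qed
qed

section \<open>Exponents and greatest common divisors\<close>

abbreviation expo :: "mon \<Rightarrow> var \<Rightarrow> nat" where
  "expo \<equiv> Poly_Mapping.lookup"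

definition mon_of :: "(var \<Rightarrow> nat) \<Rightarrow> mon" where
  "mon_of f = Poly_Mapping.single VarX (f VarX) + Poly_Mapping.single VarY (f VarY)
     + Poly_Mapping.single VarZ (f VarZ)"

lemma expo_mon_of [simp]: "expo (mon_of f) v = f v"
  by (cases v) (simp_all add: mon_of_def lookup_add lookup_single)

lemma all_var: "(\<forall>v. P v) \<longleftrightarrow> P VarX \<and> P VarY \<and> P VarZ"
  by (metis var.exhaust)

lemma mon_eq_iff:
  "m = n \<longleftrightarrow> expo m VarX = expo n VarX \<and> expo m VarY = expo n VarY \<and> expo m VarZ = expo n VarZ"
  by (simp add: poly_mapping_eq_iff fun_eq_iff all_var)

lemma mdvd_iff_expo: "m mdvd n \<longleftrightarrow> (\<forall>v. expo m v \<le> expo n v)"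
proof
  assume "\<forall>v. expo m v \<le> expo n v"
  then have "n = m + mon_of (\<lambda>v. expo n v - expo m v)"
    by (intro poly_mapping_eqI) (simp add: lookup_add)
  then show "m mdvd n" unfolding mdvd_def by blast
qed (auto simp: mdvd_def lookup_add)

lemma mdvd_refl [simp]: "m mdvd m"
  by (simp add: mdvd_iff_expo)

lemma mdvd_trans: "l mdvd m \<Longrightarrow> m mdvd n \<Longrightarrow> l mdvd n"
  by (meson mdvd_iff_expo order_trans)

lemma mdvd_mdeg_le: "m mdvd n \<Longrightarrow> mdeg m \<le> mdeg n"
  by (auto simp: mdvd_def)

lemma mdvd_mdeg_eq: "m mdvd n \<Longrightarrow> mdeg n \<le> mdeg m \<Longrightarrow> m = n"
  by (auto simp: mdvd_iff_expo all_var mdeg_def mon_eq_iff)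

lemma mdvd_add_cancel: "m + n mdvd k + n \<longleftrightarrow> m mdvd k"
  by (simp add: mdvd_iff_expo lookup_add)

lemma mdeg_single [simp]: "mdeg (Poly_Mapping.single v c) = c"
  by (cases v) (simp_all add: mdeg_def lookup_single)

definition mgcd :: "mon \<Rightarrow> mon \<Rightarrow> mon" where
  "mgcd m n = mon_of (\<lambda>v. min (expo m v) (expo n v))"

lemma expo_mgcd [simp]: "expo (mgcd m n) v = min (expo m v) (expo n v)"
  by (simp add: mgcd_def)

lemma mgcd_mdvd: "mgcd m n mdvd m" "mgcd m n mdvd n"
  by (simp_all add: mdvd_iff_expo)

text \<open>Degrees satisfy \<open>deg g + deg h = deg lcm + deg gcd\<close>; any common multiple may stand in for the
  least one.\<close>

lemma mdeg_common_multiple: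
  assumes "m mdvd u" "n mdvd u"
  shows "mdeg m + mdeg n \<le> mdeg u + mdeg (mgcd m n)"
proof -
  have "expo m v + expo n v \<le> expo u v + expo (mgcd m n) v" for v
    using assms by (auto simp: mdvd_iff_expo min_def)
  from this[of VarX] this[of VarY] this[of VarZ] show ?thesis
    unfolding mdeg_def by linarith
qed

section \<open>Excess of upward closed sets of monomials\<close>

definition up_closed :: "mon set \<Rightarrow> bool" where
  "up_closed A \<longleftrightarrow> (\<forall>m\<in>A. \<forall>n. m mdvd n \<longrightarrow> n \<in> A)"

definition ups :: "nat \<Rightarrow> mon set \<Rightarrow> mon set" where
  "ups d A = {m \<in> A. mdeg m + 1 = d}"

definition downs :: "nat \<Rightarrow> mon set \<Rightarrow> mon set" where
  "downs d A = {m \<in> A. mdeg m + 2 = d}"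

definition excess :: "nat \<Rightarrow> mon set \<Rightarrow> int" where
  "excess d A = int (card (ups d A)) - int (card (downs d A))"

definition multiples :: "mon \<Rightarrow> mon set" where
  "multiples n = {m. n mdvd m}"

definition gen :: "mon set \<Rightarrow> mon set" where
  "gen G = (\<Union>g\<in>G. multiples g)"

lemma up_closed_Int: "up_closed A \<Longrightarrow> up_closed B \<Longrightarrow> up_closed (A \<inter> B)"
  by (auto simp: up_closed_def)

lemma up_closed_multiples: "up_closed (multiples n)"
  by (auto simp: up_closed_def multiples_def intro: mdvd_trans)

lemma multiples_mono: "n mdvd m \<Longrightarrow> multiples m \<subseteq> multiples n"
  by (auto simp: multiples_def intro: mdvd_trans)

lemma up_closed_gen: "up_closed (gen G)"
  using up_closed_multiples by (auto simp: gen_def up_closed_def)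

lemma finite_ups [simp]: "finite (ups d A)"
  by (rule finite_subset[OF _ finite_mdeg_less[of d]]) (auto simp: ups_def)

lemma finite_downs [simp]: "finite (downs d A)"
  by (rule finite_subset[OF _ finite_mdeg_less[of d]]) (auto simp: downs_def)

lemma excess_cong:
  assumes "\<And>m. mdeg m < d \<Longrightarrow> m \<in> A \<longleftrightarrow> m \<in> B"
  shows "excess d A = excess d B"
proof -
  have "ups d A = ups d B" "downs d A = downs d B"
    using assms by (auto simp: ups_def downs_def)
  then show ?thesis by (simp add: excess_def)
qed

lemma excess_Un_Int: "excess d (A \<union> B) + excess d (A \<inter> B) = excess d A + excess d B"
proof -
  have "ups d (A \<union> B) = ups d A \<union> ups d B" "ups d (A \<inter> B) = ups d A \<inter> ups d B"
    "downs d (A \<union> B) = downs d A \<union> downs d B" "downs d (A \<inter> B) = downs d A \<inter> downs d B"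
    by (auto simp: ups_def downs_def)
  then show ?thesis
    using card_Un_Int[OF finite_ups finite_ups, of d A d B]
      card_Un_Int[OF finite_downs finite_downs, of d A d B]
    by (simp add: excess_def)
qed

text \<open>Multiplication by a variable \<open>w\<close> maps degree \<open>d - 2\<close> injectively into degree \<open>d - 1\<close>, so the
  excess counts the monomials missed by it.\<close>

lemma excess_cross_section:
  assumes "up_closed A"
  shows "excess d A = int (card {m \<in> ups d A. \<forall>k\<in>A. m \<noteq> mvar w + k})"
proof -
  let ?f = "(+) (mvar w)"
  have sub: "?f ` downs d A \<subseteq> ups d A"
    using assms by (auto simp: downs_def ups_def up_closed_def mdvd_def) (metis add.commute)
  have "{m \<in> ups d A. \<forall>k\<in>A. m \<noteq> mvar w + k} = ups d A - ?f ` downs d A"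
    by (auto simp: downs_def ups_def)
  moreover have "card (?f ` downs d A) = card (downs d A)"
    by (rule card_image) simp
  moreover have "card (?f ` downs d A) \<le> card (ups d A)"
    using sub by (simp add: card_mono)
  ultimately show ?thesis
    using sub by (simp add: excess_def card_Diff_subset of_nat_diff)
qed

text \<open>In every strip met by \<open>A\<close>, a monomial with least exponent of another variable \<open>w\<close> cannot be
  divided by \<open>w\<close> inside \<open>A\<close>, and so contributes to the cross section.\<close>

lemma strips_le_excess:
  assumes A: "up_closed A"
  shows "int (card ((\<lambda>m. expo m v) ` ups d A)) \<le> excess d A"
proof -
  obtain w where w: "w \<noteq> v" by (metis var.distinct(1))
  let ?C = "{m \<in> ups d A. \<forall>k\<in>A. m \<noteq> mvar w + k}"
  have "(\<lambda>m. expo m v) ` ups d A \<subseteq> (\<lambda>m. expo m v) ` ?C"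
  proof
    fix a assume "a \<in> (\<lambda>m. expo m v) ` ups d A"
    then obtain m0 where "m0 \<in> ups d A \<and> expo m0 v = a" by blast
    then obtain m where m: "m \<in> ups d A \<and> expo m v = a"
      and least: "\<And>n. n \<in> ups d A \<and> expo n v = a \<Longrightarrow> expo m w \<le> expo n w"
      using ex_has_least_nat[of "\<lambda>m. m \<in> ups d A \<and> expo m v = a" m0 "\<lambda>m. expo m w"] by blast
    have "m \<noteq> mvar w + k" if k: "k \<in> A" for k
    proof
      assume eq: "m = mvar w + k"
      \<comment> \<open>Trading the factor \<open>w\<close> for the third variable \<open>u\<close> stays in the strip and lowers the
        exponent of \<open>w\<close>.\<close>
      obtain u where u: "u \<noteq> w" "u \<noteq> v"
        by (cases v; cases w) auto
      have "k mdvd mvar u + k" unfolding mdvd_def by (metis add.commute)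
      then have "mvar u + k \<in> A" using A k by (auto simp: up_closed_def)
      then have "mvar u + k \<in> ups d A" using m eq by (simp add: ups_def)
      moreover have "expo (mvar u + k) v = a"
        using m eq u w by (simp add: lookup_add lookup_single when_def)
      ultimately have "expo m w \<le> expo (mvar u + k) w" using least by blast
      then show False using eq u by (simp add: lookup_add lookup_single when_def)
    qed
    with m show "a \<in> (\<lambda>m. expo m v) ` ?C" by blast
  qed
  then have "card ((\<lambda>m. expo m v) ` ups d A) \<le> card ((\<lambda>m. expo m v) ` ?C)"
    by (intro card_mono finite_imageI) auto
  also have "\<dots> \<le> card ?C" by (rule card_image_le) auto
  finally show ?thesis using excess_cross_section[OF A, of d w] by simp
qed

lemma excess_nonneg: "up_closed A \<Longrightarrow> 0 \<le> excess d A"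
  using strips_le_excess[of A VarX d] by linarith

lemma excess_zero_iff:
  assumes "up_closed A"
  shows "excess d A = 0 \<longleftrightarrow> ups d A = {}"
proof
  assume "excess d A = 0"
  then show "ups d A = {}" using strips_le_excess[OF assms, of VarX d] by simp
next
  assume "ups d A = {}"
  then show "excess d A = 0" using excess_nonneg[OF assms, of d] by (simp add: excess_def)
qed

lemma strips_multiples:
  "{expo n v..<expo n v + (d - mdeg n)} \<subseteq> (\<lambda>m. expo m v) ` ups d (multiples n)"
proof
  fix a assume a: "a \<in> {expo n v..<expo n v + (d - mdeg n)}"
  obtain w where w: "w \<noteq> v" by (metis var.distinct(1))
  let ?m = "n + Poly_Mapping.single v (a - expo n v)
    + Poly_Mapping.single w (d - 1 - mdeg n - (a - expo n v))"
  have "?m \<in> ups d (multiples n)"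
    using a by (auto simp: ups_def multiples_def mdvd_def add.assoc)
  moreover have "expo ?m v = a"
    using a w by (simp add: lookup_add lookup_single when_def)
  ultimately show "a \<in> (\<lambda>m. expo m v) ` ups d (multiples n)" by force
qed

text \<open>The monomials of degree \<open>d - 1\<close> on the edge of the triangle where the exponent of \<open>y\<close> is least
  are the cross section, and each strip in the direction of \<open>x\<close> meets that edge once.\<close>

lemma excess_multiples: "excess d (multiples n) = int (d - mdeg n)"
proof (rule antisym)
  \<comment> \<open>On the cross section the exponent of \<open>y\<close> is constant, so that of \<open>x\<close> determines the monomial.\<close>
  let ?C = "{m \<in> ups d (multiples n). \<forall>k\<in>multiples n. m \<noteq> mvar VarY + k}"
  have y: "expo m VarY = expo n VarY" if m: "m \<in> ?C" for m
  proof (rule ccontr)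
    assume ne: "expo m VarY \<noteq> expo n VarY"
    have le: "expo n v \<le> expo m v" for v
      using m by (auto simp: ups_def multiples_def mdvd_iff_expo)
    have lt: "expo n VarY < expo m VarY" using ne le[of VarY] by simp
    let ?k = "mon_of ((expo m)(VarY := expo m VarY - 1))"
    have "m = mvar VarY + ?k"
      using lt by (intro poly_mapping_eqI) (auto simp: lookup_add lookup_single when_def)
    moreover have "?k \<in> multiples n"
      using lt le by (auto simp: multiples_def mdvd_iff_expo)
    ultimately show False using m by blast
  qed
  have "inj_on (\<lambda>m. expo m VarX) ?C"
  proof (rule inj_onI)
    fix m m' assume mm: "m \<in> ?C" "m' \<in> ?C" "expo m VarX = expo m' VarX"
    then have "expo m VarZ = expo m' VarZ"
      using y[OF mm(1)] y[OF mm(2)] by (auto simp: ups_def mdeg_def)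
    with mm(3) y[OF mm(1)] y[OF mm(2)] show "m = m'"
      by (simp add: mon_eq_iff)
  qed
  moreover have "(\<lambda>m. expo m VarX) ` ?C \<subseteq> {expo n VarX..<expo n VarX + (d - mdeg n)}"
  proof -
    have "expo m VarX \<in> {expo n VarX..<expo n VarX + (d - mdeg n)}" if "m \<in> ?C" for m
    proof -
      have "\<forall>v. expo n v \<le> expo m v" "mdeg m + 1 = d"
        using that by (auto simp: ups_def multiples_def mdvd_iff_expo)
      then have "expo n VarX \<le> expo m VarX" "expo n VarY \<le> expo m VarY" "expo n VarZ \<le> expo m VarZ"
        "mdeg m + 1 = d" by auto
      then show ?thesis unfolding mdeg_def by simp
    qed
    then show ?thesis by blast
  qed
  ultimately have "card ?C \<le> d - mdeg n"
    by (metis (no_types, lifting) card_atLeastLessThan card_image card_mono diff_add_inverse finite_atLeastLessThan)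
  then show "excess d (multiples n) \<le> int (d - mdeg n)"
    using excess_cross_section[OF up_closed_multiples, of d n VarY] by simp
next
  have "d - mdeg n \<le> card ((\<lambda>m. expo m VarX) ` ups d (multiples n))"
    using card_mono[OF _ strips_multiples[of n VarX d]] by simp
  then show "int (d - mdeg n) \<le> excess d (multiples n)"
    using strips_le_excess[OF up_closed_multiples, of VarX d n] by linarith
qed

text \<open>Let \<open>g\<close> be the greatest common divisor. When \<open>m / g\<close> is a power of \<open>v\<close>, the triangle of \<open>m\<close>
  covers the upper \<open>v\<close>-strips of the triangle of \<open>g\<close>, and the triangle of \<open>n\<close> covers the lower ones
  up to the point where that of \<open>m\<close> starts, by the degree hypothesis. So \<open>A\<close> already meets all
  \<open>d - deg g\<close> strips of the triangle of \<open>g\<close>, and adding that triangle gains nothing.\<close>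

lemma excess_gcd_merge_aux:
  assumes A: "up_closed A" "multiples m \<subseteq> A" "multiples n \<subseteq> A"
    and deg: "mdeg m + mdeg n \<le> d + mdeg (mgcd m n)"
    and pure: "\<And>w. w \<noteq> v \<Longrightarrow> expo m w \<le> expo n w"
  shows "excess d (A \<union> multiples (mgcd m n)) \<le> excess d A"
proof -
  let ?g = "mgcd m n"
  let ?B = "A \<inter> multiples ?g"
  let ?S = "\<lambda>n. {expo n v..<expo n v + (d - mdeg n)}"
  have m: "mdeg m + expo ?g v = mdeg ?g + expo m v"
    using pure by (cases v) (auto simp: mdeg_def min_def)
  have "?S ?g \<subseteq> ?S m \<union> ?S n"
  proof (cases "expo m v \<le> expo n v")
    case True
    then have "?g = m" using pure by (intro poly_mapping_eqI) (metis expo_mgcd min_def)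
    then show ?thesis by auto
  next
    case False
    then have "expo ?g v = expo n v" by simp
    moreover have "mdeg ?g \<le> mdeg m" "mdeg ?g \<le> mdeg n"
      by (simp_all add: mgcd_mdvd mdvd_mdeg_le)
    ultimately show ?thesis using m deg by auto
  qed
  also have "\<dots> \<subseteq> (\<lambda>m. expo m v) ` ups d (multiples m) \<union> (\<lambda>m. expo m v) ` ups d (multiples n)"
    by (intro Un_mono strips_multiples)
  also have "\<dots> \<subseteq> (\<lambda>m. expo m v) ` ups d ?B"
  proof -
    have "multiples m \<subseteq> ?B" "multiples n \<subseteq> ?B"
      using A(2,3) mgcd_mdvd[THEN multiples_mono] by auto
    then show ?thesis by (auto simp: ups_def)
  qed
  finally have "d - mdeg ?g \<le> card ((\<lambda>m. expo m v) ` ups d ?B)"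
    using card_mono[of "(\<lambda>m. expo m v) ` ups d ?B" "?S ?g"] by simp
  then have "int (d - mdeg ?g) \<le> excess d ?B"
    using strips_le_excess[OF up_closed_Int[OF A(1) up_closed_multiples], of v d ?g] by linarith
  then show ?thesis
    using excess_Un_Int[of d A "multiples ?g"] excess_multiples[of d ?g] by linarith
qed

text \<open>The hypothesis says that the least common multiple has degree at most \<open>d\<close>. With only three
  variables, one of \<open>m / gcd\<close> and \<open>n / gcd\<close> is a power of a single variable.\<close>

lemma excess_gcd_merge:
  assumes A: "up_closed A" "multiples m \<subseteq> A" "multiples n \<subseteq> A"
    and deg: "mdeg m + mdeg n \<le> d + mdeg (mgcd m n)"
  shows "excess d (A \<union> multiples (mgcd m n)) \<le> excess d A"
proof -
  have comm: "mgcd n m = mgcd m n"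
    by (rule poly_mapping_eqI) (simp add: min.commute)
  have "\<exists>v. (\<forall>w. w \<noteq> v \<longrightarrow> expo m w \<le> expo n w) \<or> (\<forall>w. w \<noteq> v \<longrightarrow> expo n w \<le> expo m w)"
  proof (rule ccontr)
    assume "\<not> ?thesis"
    then show False by (simp add: all_var) linarith
  qed
  then obtain v where "(\<forall>w. w \<noteq> v \<longrightarrow> expo m w \<le> expo n w) \<or> (\<forall>w. w \<noteq> v \<longrightarrow> expo n w \<le> expo m w)"
    by blast
  then show ?thesis
    using excess_gcd_merge_aux[of A m n d v] excess_gcd_merge_aux[of A n m d v] A deg
    by (auto simp: comm add.commute)
qed

section \<open>Overlapping triangles\<close>

text \<open>It suffices to look at degree \<open>d - 1\<close>: a common downward triangle has common upward neighbours.\<close>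

definition non_overlapping :: "nat \<Rightarrow> mon set \<Rightarrow> bool" where
  "non_overlapping d G \<longleftrightarrow>
    (\<forall>g\<in>G. \<forall>h\<in>G. g \<noteq> h \<longrightarrow> ups d (multiples g \<inter> multiples h) = {})"

lemma gen_insert: "gen (insert h G) = multiples h \<union> gen G"
  by (simp add: gen_def)

lemma excess_gen_le: "finite G \<Longrightarrow> excess d (gen G) \<le> (\<Sum>g\<in>G. int (d - mdeg g))"
proof (induction G rule: finite_induct)
  case empty
  then show ?case by (simp add: gen_def excess_def ups_def downs_def)
next
  case (insert h G)
  have "0 \<le> excess d (multiples h \<inter> gen G)"
    by (intro excess_nonneg up_closed_Int up_closed_multiples up_closed_gen)
  then show ?case
    using insert excess_Un_Int[of d "multiples h" "gen G"] excess_multiples[of d h]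
    by (simp add: gen_insert)
qed

text \<open>When triangles are added one at a time, each loses the excess of its intersection with the
  previous ones. Equality forces these excesses to vanish, and an upward closed set of excess \<open>0\<close> is empty
  in degree \<open>d - 1\<close>.\<close>

lemma excess_gen_eq_imp_non_overlapping:
  "finite G \<Longrightarrow> excess d (gen G) = (\<Sum>g\<in>G. int (d - mdeg g)) \<Longrightarrow> non_overlapping d G"
proof (induction G rule: finite_induct)
  case empty
  then show ?case by (simp add: non_overlapping_def)
next
  case (insert h G)
  have up: "up_closed (multiples h \<inter> gen G)"
    by (intro up_closed_Int up_closed_multiples up_closed_gen)
  have "excess d (gen G) + (d - mdeg h) = excess d (gen (insert h G)) + excess d (multiples h \<inter> gen G)"
    using excess_Un_Int[of d "multiples h" "gen G"] excess_multiples[of d h]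
    by (simp add: gen_insert)
  with insert.prems insert.hyps excess_gen_le[OF insert.hyps(1), of d] excess_nonneg[OF up, of d]
  have "excess d (gen G) = (\<Sum>g\<in>G. int (d - mdeg g))" and "excess d (multiples h \<inter> gen G) = 0"
    by simp_all
  then have G: "non_overlapping d G" and "ups d (multiples h \<inter> gen G) = {}"
    using insert.IH excess_zero_iff[OF up] by blast+
  then have h: "\<forall>g\<in>G. ups d (multiples h \<inter> multiples g) = {}"
    by (auto simp: ups_def gen_def)
  show ?case
    using G h by (auto simp: non_overlapping_def Int_commute)
qed

lemma excess_Int_gen:
  assumes "finite G" "non_overlapping d G" "up_closed B"
  shows "excess d (B \<inter> gen G) = (\<Sum>g\<in>G. excess d (B \<inter> multiples g))"
  using assms
proof (induction G rule: finite_induct)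
  case empty
  then show ?case by (simp add: gen_def excess_def ups_def downs_def)
next
  case (insert h G)
  let ?V = "(B \<inter> multiples h) \<inter> (B \<inter> gen G)"
  have "up_closed ?V"
    by (intro up_closed_Int up_closed_multiples up_closed_gen insert.prems)
  moreover have "ups d (multiples h \<inter> multiples g) = {}" if "g \<in> G" for g
    using insert.prems(1) insert.hyps(2) that unfolding non_overlapping_def
    by (metis insertI1 insertI2)
  then have "ups d ?V = {}" by (auto simp: gen_def ups_def)
  ultimately have "excess d ?V = 0" by (simp add: excess_zero_iff)
  moreover have "non_overlapping d G" using insert.prems(1) by (simp add: non_overlapping_def)
  moreover have "B \<inter> gen (insert h G) = (B \<inter> multiples h) \<union> (B \<inter> gen G)"
    by (auto simp: gen_insert)
  ultimately show ?case
    using insert excess_Un_Int[of d "B \<inter> multiples h" "B \<inter> gen G"] by simp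
qed

section \<open>Punctures and over-punctured subregions\<close>

definition punctures :: "nat \<Rightarrow> mon set \<Rightarrow> mon set" where
  "punctures d A = {g \<in> A. mdeg g < d \<and> (\<forall>h\<in>A. h mdvd g \<longrightarrow> h = g)}"

definition side_sum :: "nat \<Rightarrow> mon set \<Rightarrow> int" where
  "side_sum d A = (\<Sum>g\<in>punctures d A. int (d - mdeg g))"

text \<open>The monomials of the colon ideal, if \<open>A\<close> are those of an ideal.\<close>

definition quot :: "mon set \<Rightarrow> mon \<Rightarrow> mon set" where
  "quot A n = {m. m + n \<in> A}"

definition no_over_punctured :: "nat \<Rightarrow> mon set \<Rightarrow> bool" where
  "no_over_punctured d A \<longleftrightarrow>
    (\<forall>n. mdeg n < d \<longrightarrow> side_sum (d - mdeg n) (quot A n) \<le> int (d - mdeg n))"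

lemma no_over_puncturedD:
  "no_over_punctured d A \<Longrightarrow> mdeg n < d \<Longrightarrow> side_sum (d - mdeg n) (quot A n) \<le> int (d - mdeg n)"
  by (simp add: no_over_punctured_def)

lemma finite_punctures [simp]: "finite (punctures d A)"
  by (rule finite_subset[OF _ finite_mdeg_less[of d]]) (auto simp: punctures_def)

lemma punctures_cong:
  assumes "\<And>m. mdeg m < d \<Longrightarrow> m \<in> A \<longleftrightarrow> m \<in> B"
  shows "punctures d A = punctures d B"
proof -
  have "h \<in> A \<longleftrightarrow> h \<in> B" if "mdeg g < d" "h mdvd g" for g h
    using assms that mdvd_mdeg_le[of h g] by simp
  then show ?thesis unfolding punctures_def using mdvd_refl by blast
qed

lemma punctures_below:
  assumes "m \<in> A" "mdeg m < d"
  obtains g where "g \<in> punctures d A" "g mdvd m"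
proof -
  obtain g where g: "g \<in> A \<and> g mdvd m"
    and least: "\<And>h. h \<in> A \<and> h mdvd m \<Longrightarrow> mdeg g \<le> mdeg h"
    using ex_has_least_nat[of "\<lambda>g. g \<in> A \<and> g mdvd m" m mdeg] assms by auto
  have "h = g" if "h \<in> A" "h mdvd g" for h
    using that g least[of h] mdvd_trans mdvd_mdeg_eq by blast
  then have "g \<in> punctures d A"
    using g assms mdvd_mdeg_le[of g m] by (auto simp: punctures_def)
  with g that show ?thesis by blast
qed

lemma gen_punctures:
  assumes "up_closed A" "mdeg m < d"
  shows "m \<in> gen (punctures d A) \<longleftrightarrow> m \<in> A"
proof
  assume "m \<in> A"
  then show "m \<in> gen (punctures d A)"
    using assms(2) by (elim punctures_below[of m A d]) (auto simp: gen_def multiples_def)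
qed (use assms(1) in \<open>auto simp: gen_def multiples_def punctures_def up_closed_def\<close>)

lemma excess_gen_punctures: "up_closed A \<Longrightarrow> excess d (gen (punctures d A)) = excess d A"
  by (intro excess_cong gen_punctures)

lemma excess_le_side_sum: "up_closed A \<Longrightarrow> excess d A \<le> side_sum d A"
  using excess_gen_le[OF finite_punctures, of d d A]
  by (simp add: excess_gen_punctures side_sum_def)

lemma excess_eq_side_sum_iff:
  assumes "up_closed A"
  shows "excess d A = side_sum d A \<longleftrightarrow> non_overlapping d (punctures d A)"
proof
  assume "excess d A = side_sum d A"
  then show "non_overlapping d (punctures d A)"
    using excess_gen_eq_imp_non_overlapping[OF finite_punctures, of d d A]
    by (simp add: excess_gen_punctures assms side_sum_def)
next
  assume "non_overlapping d (punctures d A)"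
  then have "excess d (UNIV \<inter> gen (punctures d A)) = side_sum d A"
    by (subst excess_Int_gen) (simp_all add: up_closed_def side_sum_def excess_multiples)
  then show "excess d A = side_sum d A" by (simp add: excess_gen_punctures assms)
qed

lemma up_closed_quot: "up_closed A \<Longrightarrow> up_closed (quot A n)"
  unfolding up_closed_def quot_def mem_Collect_eq using mdvd_add_cancel by blast

lemma excess_quot:
  assumes "mdeg n < d"
  shows "excess (d - mdeg n) (quot A n) = excess d (A \<inter> multiples n)"
proof -
  have "(\<lambda>m. m + n) ` ups (d - mdeg n) (quot A n) = ups d (A \<inter> multiples n)"
    and "(\<lambda>m. m + n) ` downs (d - mdeg n) (quot A n) = downs d (A \<inter> multiples n)"
    using assms
    by (auto simp: ups_def downs_def quot_def multiples_def mdvd_def add.commute image_iff; force)+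
  then have "card (ups d (A \<inter> multiples n)) = card (ups (d - mdeg n) (quot A n))"
    and "card (downs d (A \<inter> multiples n)) = card (downs (d - mdeg n) (quot A n))"
    by (metis card_image inj_on_def add_right_cancel)+
  then show ?thesis by (simp add: excess_def)
qed

text \<open>If the punctures of \<open>g\<close> and \<open>h\<close> overlap, the subregion of \<open>gcd g h\<close> is a triangle of side less
  than the sum of the sides of these two, which are punctures of it as well.\<close>

lemma no_over_punctured_imp_non_overlapping:
  assumes small: "no_over_punctured d A"
  shows "non_overlapping d (punctures d A)"
  unfolding non_overlapping_def
proof (intro ballI impI, rule ccontr)
  fix g h assume gh: "g \<in> punctures d A" "h \<in> punctures d A" "g \<noteq> h"
  assume "ups d (multiples g \<inter> multiples h) \<noteq> {}"
  then obtain u where u: "g mdvd u" "h mdvd u" "mdeg u + 1 = d"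
    by (auto simp: ups_def multiples_def)
  let ?n = "mgcd g h"
  obtain g' h' where g': "g = ?n + g'" and h': "h = ?n + h'"
    using mgcd_mdvd unfolding mdvd_def by blast
  \<comment> \<open>A generator of \<open>A\<close> divisible by \<open>n\<close> yields a generator after division by \<open>n\<close>.\<close>
  have quot_gen: "k \<in> punctures (d - mdeg ?n) (quot A ?n)" if k: "?n + k \<in> punctures d A" for k
  proof -
    have "l = k" if "l + ?n \<in> A" "l mdvd k" for l
      using k that mdvd_add_cancel[of l ?n k] by (auto simp: punctures_def add.commute)
    then show ?thesis using k by (auto simp: punctures_def quot_def add.commute)
  qed
  have "int (d - mdeg ?n - mdeg g') + int (d - mdeg ?n - mdeg h')
      = (\<Sum>k\<in>{g', h'}. int (d - mdeg ?n - mdeg k))"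
    using gh(3) g' h' by (subst sum.insert) auto
  also have "\<dots> \<le> side_sum (d - mdeg ?n) (quot A ?n)"
    unfolding side_sum_def using quot_gen[of g'] quot_gen[of h'] gh g' h'
    by (intro sum_mono2) auto
  also have "\<dots> \<le> int (d - mdeg ?n)"
    using u mgcd_mdvd[of g h] mdvd_mdeg_le[of g u] mdvd_mdeg_le[of ?n g]
    by (intro no_over_puncturedD[OF small]) linarith
  finally have "int (d - mdeg ?n - mdeg g') + int (d - mdeg ?n - mdeg h') \<le> int (d - mdeg ?n)" .
  moreover have "mdeg g = mdeg ?n + mdeg g'" "mdeg h = mdeg ?n + mdeg h'"
    using g' h' mdeg_add by metis+
  moreover have "mdeg g + mdeg h \<le> mdeg u + mdeg ?n" using u mdeg_common_multiple by blast
  moreover have "mdeg g \<le> mdeg u" "mdeg h \<le> mdeg u" using u mdvd_mdeg_le by blast+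
  ultimately show False using u(3) by linarith
qed

text \<open>Each puncture of a subregion lies in a puncture of the whole. Two overlapping ones would lie
  in the same puncture \<open>g\<close>, and then their greatest common divisor would lie there too, against
  minimality.\<close>

lemma non_overlapping_quot:
  assumes up: "up_closed A" and no: "non_overlapping d (punctures d A)" and n: "mdeg n < d"
  shows "non_overlapping (d - mdeg n) (punctures (d - mdeg n) (quot A n))"
  unfolding non_overlapping_def
proof (intro ballI impI, rule ccontr)
  let ?e = "d - mdeg n"
  fix h k assume hk: "h \<in> punctures ?e (quot A n)" "k \<in> punctures ?e (quot A n)" "h \<noteq> k"
  assume "ups ?e (multiples h \<inter> multiples k) \<noteq> {}"
  then obtain u where u: "h mdvd u" "k mdvd u" "mdeg u + 1 = ?e"
    by (auto simp: ups_def multiples_def)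
  have "h + n \<in> A" "mdeg (h + n) < d" "k + n \<in> A" "mdeg (k + n) < d"
    using hk n by (auto simp: punctures_def quot_def)
  then obtain g g' where g: "g \<in> punctures d A" "g mdvd h + n"
    and g': "g' \<in> punctures d A" "g' mdvd k + n"
    by (metis punctures_below)
  have "u + n \<in> ups d (multiples g \<inter> multiples g')"
    using u g(2) g'(2) mdvd_trans mdvd_add_cancel by (fastforce simp: ups_def multiples_def)
  then have "g = g'" using no g(1) g'(1) unfolding non_overlapping_def by blast
  let ?l = "mgcd h k"
  have "g mdvd ?l + n"
    using g(2) g'(2) \<open>g = g'\<close> by (auto simp: mdvd_iff_expo lookup_add min_def)
  then have "?l \<in> quot A n"
    using up g(1) by (auto simp: up_closed_def quot_def punctures_def)
  then have "?l = h" "?l = k"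
    using hk mgcd_mdvd[of h k] by (auto simp: punctures_def)
  then show False using hk(3) by simp
qed

text \<open>Induction on the number of generators. If two of them overlap, replace them by their greatest
  common divisor. Otherwise both sides decompose over the triangles generated by \<open>G\<close>, and in each
  triangle the excess of \<open>A\<close> is at most the side sum of its punctures there, hence at most the side of
  the triangle.\<close>

lemma excess_minimal_if_no_over_punctured:
  assumes A: "up_closed A"
    and small: "no_over_punctured d A"
    and "finite G" and "\<And>m. m \<in> A \<Longrightarrow> mdeg m < d \<Longrightarrow> m \<in> gen G"
  shows "excess d A \<le> excess d (gen G)"
  using assms(3,4)
proof (induction "card G" arbitrary: G rule: less_induct)
  case less
  show ?case
  proof (cases "non_overlapping d G")
    case True
    have piece: "excess d (A \<inter> multiples g) \<le> int (d - mdeg g)" for g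
    proof (cases "mdeg g < d")
      case True
      then show ?thesis
        using excess_le_side_sum[OF up_closed_quot[OF A], of "d - mdeg g" g] no_over_puncturedD[OF small, of g]
        by (simp add: excess_quot)
    next
      case False
      then have "ups d (A \<inter> multiples g) = {}"
        using mdvd_mdeg_le by (fastforce simp: ups_def multiples_def)
      then show ?thesis by (simp add: excess_def)
    qed
    have "excess d A = excess d (A \<inter> gen G)"
      using less.prems(2) by (intro excess_cong) auto
    also have "\<dots> = (\<Sum>g\<in>G. excess d (A \<inter> multiples g))"
      by (rule excess_Int_gen[OF less.prems(1) True A])
    also have "\<dots> \<le> (\<Sum>g\<in>G. int (d - mdeg g))"
      by (intro sum_mono piece)
    also have "\<dots> = excess d (gen G)"
      using excess_Int_gen[OF less.prems(1) True, of UNIV]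
      by (simp add: up_closed_def excess_multiples)
    finally show ?thesis .
  next
    case False
    then obtain g h u where gh: "g \<in> G" "h \<in> G" "g \<noteq> h"
      and u: "g mdvd u" "h mdvd u" "mdeg u + 1 = d"
      by (auto simp: non_overlapping_def ups_def multiples_def)
    let ?k = "mgcd g h"
    let ?G = "insert ?k (G - {g, h})"
    have sub: "multiples g \<subseteq> multiples ?k" "multiples h \<subseteq> multiples ?k"
      by (intro multiples_mono mgcd_mdvd)+
    then have gen: "gen ?G = gen G \<union> multiples ?k"
      using gh by (auto simp: gen_def)
    have "card {g, h} \<le> card G"
      using gh less.prems(1) by (intro card_mono) auto
    then have "card ?G < card G"
      using gh less.prems(1) by (auto simp: card_insert_if card_Diff_subset)
    then have "excess d A \<le> excess d (gen ?G)"
      using less.prems by (intro less.hyps) (auto simp: gen)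
    also have "\<dots> \<le> excess d (gen G)"
      unfolding gen using gh u mdeg_common_multiple[of g u h]
      by (intro excess_gcd_merge up_closed_gen) (auto simp: gen_def)
    finally show ?thesis .
  qed
qed

section \<open>Tilings\<close>

text \<open>Every lozenge contains exactly one triangle of either orientation.\<close>

lemma tileable_iff_bij:
  "tileable (Up ` X \<union> Down ` Y) \<longleftrightarrow>
    (\<exists>\<sigma>. bij_betw \<sigma> Y X \<and> (\<forall>m\<in>Y. \<exists>v. \<sigma> m = mvar v + m))"
    (is "tileable ?T \<longleftrightarrow> _")
proof
  assume "tileable ?T"
  then consider "?T = {}" | P where "partition_on ?T P" "\<forall>L\<in>P. lozenge L"
    unfolding tileable_def by blast
  then show "\<exists>\<sigma>. bij_betw \<sigma> Y X \<and> (\<forall>m\<in>Y. \<exists>v. \<sigma> m = mvar v + m)"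
  proof cases
    case 1
    then show ?thesis by (auto simp: bij_betw_def)
  next
    case (2 P)
    have union: "\<Union>P = ?T" using 2(1) by (simp add: partition_on_def)
    have same: "L = L'" if "L \<in> P" "L' \<in> P" "t \<in> L" "t \<in> L'" for L L' t
      using disjointD[OF partition_onD2[OF 2(1)], of L L'] that by blast
    have "\<exists>u. {Down m, Up u} \<in> P \<and> (\<exists>v. u = mvar v + m)" if "m \<in> Y" for m
    proof -
      have "Down m \<in> \<Union>P" unfolding union using that by simp
      then obtain L where L: "L \<in> P" "Down m \<in> L" by (rule UnionE)
      then obtain m' v where eq: "L = {Down m', Up (mvar v + m')}"
        using 2(2) unfolding lozenge_def by blast
      with L have "m' = m" by simp
      with L eq show ?thesis by blast
    qed
    then obtain \<sigma> where \<sigma>: "\<And>m. m \<in> Y \<Longrightarrow> {Down m, Up (\<sigma> m)} \<in> P"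
      "\<And>m. m \<in> Y \<Longrightarrow> \<exists>v. \<sigma> m = mvar v + m"
      by metis
    have "inj_on \<sigma> Y"
    proof (rule inj_onI)
      fix m m' assume m: "m \<in> Y" "m' \<in> Y" "\<sigma> m = \<sigma> m'"
      then have "{Down m, Up (\<sigma> m)} = {Down m', Up (\<sigma> m')}"
        using same[OF \<sigma>(1) \<sigma>(1), of m m' "Up (\<sigma> m)"] by simp
      then show "m = m'" by (auto simp: doubleton_eq_iff)
    qed
    moreover have "\<sigma> ` Y \<subseteq> X"
    proof
      fix u assume "u \<in> \<sigma> ` Y"
      then have "Up u \<in> \<Union>P" using \<sigma>(1) by blast
      then show "u \<in> X" using union by auto
    qed
    moreover have "X \<subseteq> \<sigma> ` Y"
    proof
      fix u assume "u \<in> X"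
      then have "Up u \<in> \<Union>P" unfolding union by simp
      then obtain L where L: "L \<in> P" "Up u \<in> L" by (rule UnionE)
      then obtain m v where "L = {Down m, Up (mvar v + m)}"
        using 2(2) unfolding lozenge_def by blast
      with L have m: "L = {Down m, Up u}" by simp
      then have "Down m \<in> \<Union>P" using L by blast
      then have "m \<in> Y" using union by auto
      then have "{Down m, Up (\<sigma> m)} = {Down m, Up u}"
        using same[OF \<sigma>(1) L(1), of m "Down m"] m by simp
      then show "u \<in> \<sigma> ` Y" using \<open>m \<in> Y\<close> by (auto simp: doubleton_eq_iff)
    qed
    ultimately show ?thesis using \<sigma>(2) by (auto simp: bij_betw_def)
  qed
next
  assume "\<exists>\<sigma>. bij_betw \<sigma> Y X \<and> (\<forall>m\<in>Y. \<exists>v. \<sigma> m = mvar v + m)"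
  then obtain \<sigma> where \<sigma>: "inj_on \<sigma> Y" "\<sigma> ` Y = X" "\<forall>m\<in>Y. \<exists>v. \<sigma> m = mvar v + m"
    by (auto simp: bij_betw_def)
  let ?P = "(\<lambda>m. {Down m, Up (\<sigma> m)}) ` Y"
  have "partition_on ?T ?P"
    unfolding partition_on_def disjoint_def using \<sigma>(1,2) by (auto simp: inj_on_def)
  moreover have "lozenge {Down m, Up (\<sigma> m)}" if "m \<in> Y" for m
    using \<sigma>(3) that unfolding lozenge_def by metis
  ultimately show "tileable ?T" unfolding tileable_def by auto
qed

lemma mdeg_one: "mdeg k = 1 \<Longrightarrow> \<exists>v. k = mvar v"
proof -
  assume k: "mdeg k = 1"
  have "\<exists>v. expo k v \<noteq> 0" using k by (rule_tac ccontr) (simp add: mdeg_def)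
  then obtain v where "expo k v \<noteq> 0" by blast
  then have "mvar v mdvd k"
    by (auto simp: mdvd_iff_expo lookup_single when_def)
  then show ?thesis using mdvd_mdeg_eq[of "mvar v" k] k by auto
qed

text \<open>Hall's condition for a set \<open>D\<close> of downward triangles: adjoining \<open>D\<close> to \<open>A\<close> adds exactly \<open>D\<close> in
  degree \<open>d - 2\<close> and the neighbours of \<open>D\<close> outside \<open>A\<close> in degree \<open>d - 1\<close>, and the excess does not
  drop.\<close>

lemma exists_matching:
  assumes A: "up_closed A"
    and small: "no_over_punctured d A"
  obtains \<sigma> where "inj_on \<sigma> (downs d (- A))" "\<sigma> ` downs d (- A) \<subseteq> ups d (- A)"
    "\<forall>m\<in>downs d (- A). \<exists>v. \<sigma> m = mvar v + m"
proof -
  let ?N = "\<lambda>m. {u \<in> ups d (- A). \<exists>v. u = mvar v + m}"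
  have "card D \<le> card (\<Union>(?N ` D))" if D: "D \<subseteq> downs d (- A)" for D
  proof -
    let ?G = "D \<union> punctures d A"
    have finD: "finite D" using D finite_downs finite_subset by blast
    have G: "m \<in> gen ?G \<longleftrightarrow> m \<in> A \<or> (\<exists>k\<in>D. k mdvd m)" if "mdeg m < d" for m
      using gen_punctures[OF A that] by (auto simp: gen_def multiples_def)
    have "ups d (gen ?G) = ups d A \<union> \<Union>(?N ` D)"
    proof (intro equalityI subsetI)
      fix u assume "u \<in> ups d (gen ?G)"
      then have u: "mdeg u + 1 = d" "u \<in> A \<or> (\<exists>k\<in>D. k mdvd u)"
        using G[of u] by (auto simp: ups_def)
      show "u \<in> ups d A \<union> \<Union>(?N ` D)"
      proof (cases "u \<in> A")
        case False
        then obtain k l where k: "k \<in> D" "u = k + l" using u(2) by (auto simp: mdvd_def)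
        moreover have "mdeg l = 1" using k u(1) D by (auto simp: downs_def)
        ultimately show ?thesis
          using False u(1) mdeg_one[of l] by (auto simp: ups_def add.commute)
      qed (use u in \<open>auto simp: ups_def\<close>)
    next
      fix u assume "u \<in> ups d A \<union> \<Union>(?N ` D)"
      then show "u \<in> ups d (gen ?G)"
        using G[of u] by (auto simp: ups_def mdvd_def add.commute)
    qed
    moreover have "ups d A \<inter> \<Union>(?N ` D) = {}" by (auto simp: ups_def)
    moreover have "finite (\<Union>(?N ` D))" by (rule finite_subset[OF _ finite_ups[of d "- A"]]) auto
    ultimately have ups: "card (ups d (gen ?G)) = card (ups d A) + card (\<Union>(?N ` D))"
      by (simp add: card_Un_disjoint)
    have "downs d (gen ?G) = downs d A \<union> D"
    proof (intro equalityI subsetI)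
      fix m assume "m \<in> downs d (gen ?G)"
      then have m: "mdeg m + 2 = d" "m \<in> A \<or> (\<exists>k\<in>D. k mdvd m)"
        using G[of m] by (auto simp: downs_def)
      moreover have "m \<in> D" if "k \<in> D" "k mdvd m" for k
        using that D m(1) mdvd_mdeg_eq[of k m] by (auto simp: downs_def)
      ultimately show "m \<in> downs d A \<union> D" by (auto simp: downs_def)
    next
      fix m assume m: "m \<in> downs d A \<union> D"
      then have "mdeg m + 2 = d" using D by (auto simp: downs_def)
      moreover have "m \<in> A \<or> (\<exists>k\<in>D. k mdvd m)"
        using m mdvd_refl unfolding downs_def by blast
      ultimately show "m \<in> downs d (gen ?G)"
        using G[of m] by (simp add: downs_def)
    qed
    moreover have "downs d A \<inter> D = {}" using D by (auto simp: downs_def)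
    ultimately have "card (downs d (gen ?G)) = card (downs d A) + card D"
      using finD by (simp add: card_Un_disjoint)
    moreover have "excess d A \<le> excess d (gen ?G)"
      using finD G by (intro excess_minimal_if_no_over_punctured[OF A small]) auto
    ultimately show ?thesis using ups by (simp add: excess_def)
  qed
  moreover have "finite (?N m)" for m by simp
  ultimately obtain \<sigma> where "inj_on \<sigma> (downs d (- A))" "\<forall>m\<in>downs d (- A). \<sigma> m \<in> ?N m"
    using hall_marriage[OF finite_downs, of d "- A" ?N] by blast
  then show ?thesis by (intro that[of \<sigma>]) auto
qed

lemma excess_Diff: "excess d (B - A) = excess d B - excess d (A \<inter> B)"
proof -
  have "(B - A) \<union> (A \<inter> B) = B" "(B - A) \<inter> (A \<inter> B) = {}" by auto
  then show ?thesis
    using excess_Un_Int[of d "B - A" "A \<inter> B"] by (simp add: excess_def ups_def downs_def)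
qed

text \<open>The full triangle has excess \<open>d\<close>, so \<open>T\<close> is balanced exactly if \<open>excess d A = int d\<close>.\<close>

lemma excess_Compl: "excess d (- A) = int d - excess d A"
proof -
  have "multiples 0 = UNIV" by (auto simp: multiples_def mdvd_iff_expo)
  then have "excess d UNIV = int d"
    using excess_multiples[of d 0] by (simp add: mdeg_def)
  then show ?thesis using excess_Diff[of d UNIV A] by (simp add: Compl_eq_Diff_UNIV)
qed

text \<open>The matching pairs a downward triangle divisible by \<open>n\<close> with an upward one divisible by \<open>n\<close>, so
  the subregion has at least as many upward as downward triangles.\<close>

lemma matching_imp_excess_Int_multiples_le:
  assumes \<sigma>: "inj_on \<sigma> (downs d (- A))" "\<sigma> ` downs d (- A) \<subseteq> ups d (- A)"
    "\<forall>m\<in>downs d (- A). \<exists>v. \<sigma> m = mvar v + m"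
  shows "excess d (A \<inter> multiples n) \<le> int (d - mdeg n)"
proof -
  have sub: "downs d (multiples n - A) \<subseteq> downs d (- A)" by (auto simp: downs_def)
  have "\<sigma> ` downs d (multiples n - A) \<subseteq> ups d (multiples n - A)"
  proof
    fix u assume "u \<in> \<sigma> ` downs d (multiples n - A)"
    then obtain m where m: "m \<in> downs d (multiples n - A)" "u = \<sigma> m" by blast
    then obtain v where "u = mvar v + m" using \<sigma>(3) sub by blast
    then have "n mdvd u"
      using m(1) mdvd_trans[of n m u]
      by (auto simp: downs_def multiples_def) (metis add.commute mdvd_def)
    moreover have "u \<in> ups d (- A)" using m sub \<sigma>(2) by blast
    ultimately show "u \<in> ups d (multiples n - A)" by (auto simp: ups_def multiples_def)
  qed
  then have "card (downs d (multiples n - A)) \<le> card (ups d (multiples n - A))"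
    using card_inj_on_le[of \<sigma>] inj_on_subset[OF \<sigma>(1) sub] by simp
  then have "0 \<le> excess d (multiples n - A)" by (simp add: excess_def)
  then show ?thesis using excess_Diff[of d "multiples n" A] excess_multiples[of d n] by simp
qed

text \<open>The statement for an arbitrary upward closed set \<open>A\<close> in place of the monomials of \<open>J(T)\<close>. The
  region sees only the degrees \<open>d - 1\<close> and \<open>d - 2\<close> of \<open>A\<close>, whereas the punctures depend on \<open>A\<close> in all
  degrees below \<open>d\<close>.\<close>

lemma any_two_conditions_imply_third:
  fixes d :: nat and A :: "mon set"
  assumes A: "up_closed A"
  defines "T \<equiv> Up ` ups d (- A) \<union> Down ` downs d (- A)"
  shows "side_sum d A = int d \<Longrightarrow> no_over_punctured d A \<Longrightarrow> tileable T"
    and "side_sum d A = int d \<Longrightarrow> tileable T \<Longrightarrow> no_over_punctured d A"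
    and "no_over_punctured d A \<Longrightarrow> tileable T \<Longrightarrow> d > 0 \<Longrightarrow> side_sum d A = int d"
proof -
  have balanced: "excess d A = int d" if "tileable T"
  proof -
    obtain \<sigma> where "bij_betw \<sigma> (downs d (- A)) (ups d (- A))"
      using \<open>tileable T\<close> unfolding T_def tileable_iff_bij by blast
    then have "card (downs d (- A)) = card (ups d (- A))" by (rule bij_betw_same_card)
    then show ?thesis using excess_Compl[of d A] by (simp add: excess_def)
  qed
  show "tileable T" if perfect: "side_sum d A = int d" and small: "no_over_punctured d A"
  proof -
    have "excess d A = int d"
      using no_over_punctured_imp_non_overlapping[OF small] perfect
      by (simp add: excess_eq_side_sum_iff[OF A, symmetric])
    then have card: "card (ups d (- A)) = card (downs d (- A))"
      using excess_Compl[of d A] by (simp add: excess_def)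
    obtain \<sigma> where \<sigma>: "inj_on \<sigma> (downs d (- A))" "\<sigma> ` downs d (- A) \<subseteq> ups d (- A)"
      "\<forall>m\<in>downs d (- A). \<exists>v. \<sigma> m = mvar v + m"
      using exists_matching[OF A small] by blast
    then have "\<sigma> ` downs d (- A) = ups d (- A)"
      using card by (intro card_subset_eq) (simp_all add: card_image)
    with \<sigma> show ?thesis unfolding T_def tileable_iff_bij bij_betw_def by blast
  qed
  show "no_over_punctured d A" if perfect: "side_sum d A = int d" and tile: "tileable T"
    unfolding no_over_punctured_def
  proof (intro allI impI)
    fix n assume n: "mdeg n < d"
    obtain \<sigma> where \<sigma>: "inj_on \<sigma> (downs d (- A))" "\<sigma> ` downs d (- A) \<subseteq> ups d (- A)"
      "\<forall>m\<in>downs d (- A). \<exists>v. \<sigma> m = mvar v + m"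
      using tile unfolding T_def tileable_iff_bij bij_betw_def by blast
    have "non_overlapping d (punctures d A)"
      using balanced[OF tile] perfect by (simp add: excess_eq_side_sum_iff[OF A, symmetric])
    then have "side_sum (d - mdeg n) (quot A n) = excess (d - mdeg n) (quot A n)"
      using non_overlapping_quot[OF A _ n] excess_eq_side_sum_iff[OF up_closed_quot[OF A]] by metis
    also have "\<dots> = excess d (A \<inter> multiples n)" by (rule excess_quot[OF n])
    also have "\<dots> \<le> int (d - mdeg n)" by (rule matching_imp_excess_Int_multiples_le[OF \<sigma>])
    finally show "side_sum (d - mdeg n) (quot A n) \<le> int (d - mdeg n)" .
  qed
  show "side_sum d A = int d" if "no_over_punctured d A" and tile: "tileable T" and "d > 0"
  proof (rule antisym)
    have "quot A 0 = A" "mdeg 0 = 0" by (simp_all add: quot_def mdeg_def)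
    then show "side_sum d A \<le> int d"
      using \<open>no_over_punctured d A\<close> \<open>d > 0\<close> by (metis diff_zero no_over_puncturedD)
    show "int d \<le> side_sum d A"
      using excess_le_side_sum[OF A, of d] balanced[OF tile] by simp
  qed
qed

section \<open>The ideal of a region\<close>

definition monomials :: "'k::field poly3 set \<Rightarrow> mon set" where
  "monomials X = {m. monomial m \<in> X}"

text \<open>For \<open>S\<close> the monomials of \<open>I\<close>, these are in degrees below \<open>d\<close> the monomials of \<open>J(T)\<close>: those whose
  whole triangle is missing from \<open>T\<close>. From degree \<open>d\<close> on the condition is void, which keeps the set
  upward closed.\<close>

definition core :: "nat \<Rightarrow> mon set \<Rightarrow> mon set" where
  "core d S = {m. \<forall>u. m mdvd u \<and> mdeg u < d \<and> d \<le> mdeg u + 2 \<longrightarrow> u \<in> S}"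

lemma up_closed_core: "up_closed (core d S)"
  unfolding up_closed_def core_def using mdvd_trans by blast

lemma core_iff:
  assumes "up_closed S" "mdeg u < d" "d \<le> mdeg u + 2"
  shows "u \<in> core d S \<longleftrightarrow> u \<in> S"
  using assms by (auto simp: core_def up_closed_def)

text \<open>Passing to \<open>J(T)\<close> commutes with dividing by \<open>n\<close>, so the punctures of a monomial subregion can be
  read off from \<open>J(T)\<close>.\<close>

lemma quot_core:
  assumes "mdeg n < d"
  shows "quot (core d S) n = core (d - mdeg n) (quot S n)"
proof -
  have "(\<forall>u. m + n mdvd u \<and> mdeg u < d \<and> d \<le> mdeg u + 2 \<longrightarrow> u \<in> S) \<longleftrightarrow>
      (\<forall>u. m mdvd u \<and> mdeg u < d - mdeg n \<and> d - mdeg n \<le> mdeg u + 2 \<longrightarrow> u + n \<in> S)"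
    (is "?L \<longleftrightarrow> ?R") for m
  proof
    assume ?L
    show ?R
    proof (intro allI impI)
      fix u assume "m mdvd u \<and> mdeg u < d - mdeg n \<and> d - mdeg n \<le> mdeg u + 2"
      then show "u + n \<in> S" using \<open>?L\<close> mdvd_add_cancel[of m n u] by auto
    qed
  next
    assume ?R
    show ?L
    proof (intro allI impI)
      fix u assume u: "m + n mdvd u \<and> mdeg u < d \<and> d \<le> mdeg u + 2"
      then obtain k where k: "u = m + k + n" by (auto simp: mdvd_def ac_simps)
      then show "u \<in> S" using \<open>?R\<close> u mdvd_add_cancel[of m n "m + k"] by auto
    qed
  qed
  then show ?thesis by (simp add: quot_def core_def)
qed

lemma monomials_mon_span: "monomials (mon_span M) = gen M"
  by (auto simp: monomials_def gen_def multiples_def monomial_in_mon_span)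

lemma up_closed_monomials: "monomial_ideal I \<Longrightarrow> up_closed (monomials I)"
  by (auto simp: monomial_ideal_def monomials_mon_span up_closed_gen)

lemma monomials_colon: "monomials (colon I n) = quot (monomials I) n"
  by (simp add: monomials_def colon_def quot_def mult_single)

lemma region_monomials: "region d X = Up ` ups d (- monomials X) \<union> Down ` downs d (- monomials X)"
  by (auto simp: region_def triangles_def ups_def downs_def monomials_def)

lemma region_core:
  assumes "up_closed (monomials X)"
  shows "region d X = Up ` ups d (- core d (monomials X)) \<union> Down ` downs d (- core d (monomials X))"
proof -
  have "ups d (- core d (monomials X)) = ups d (- monomials X)"
    "downs d (- core d (monomials X)) = downs d (- monomials X)"
    using core_iff[OF assms] by (auto simp: ups_def downs_def)
  then show ?thesis by (simp add: region_monomials)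
qed

lemma in_monomials_iff_region:
  assumes "mdeg u < d" "d \<le> mdeg u + 2"
  shows "u \<in> monomials X \<longleftrightarrow> (Up u \<notin> region d X \<and> Down u \<notin> region d X)"
proof -
  have "mdeg u + 1 = d \<or> mdeg u + 2 = d" using assms by linarith
  then show ?thesis by (auto simp: region_def triangles_def monomials_def)
qed

text \<open>Colon ideals enter through their monomials only: replacing \<open>X\<close> by the ideal generated by its
  monomials does not change the region.\<close>

lemma monomials_largest_ideal:
  fixes X :: "'k::field poly3 set"
  assumes X: "up_closed (monomials X)" and d: "d \<ge> 1" and m: "mdeg m < d"
  shows "m \<in> monomials (largest_ideal d (region d X) :: 'k poly3 set) \<longleftrightarrow> m \<in> core d (monomials X)"
proof -
  let ?I = "mon_span (monomials X) :: 'k poly3 set"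
  have "monomials ?I = monomials X"
    using X by (auto simp: monomials_mon_span gen_def multiples_def up_closed_def)
  then have region: "region d X = region d ?I" by (simp add: region_monomials)
  have ideal: "monomial_ideal ?I" by (auto simp: monomial_ideal_def)
  let ?L = "largest_ideal d (region d X) :: 'k poly3 set"
  have L: "ideal_for d (region d X) ?L" "ideal_for d (region d X) J \<Longrightarrow> J \<subseteq> ?L" for J
    using largest_ideal_region[OF ideal d] by (simp_all add: region)
  show ?thesis
  proof
    assume "m \<in> monomials ?L"
    moreover have "up_closed (monomials ?L)"
      using L(1) by (auto simp: ideal_for_def monomials_mon_span up_closed_gen)
    moreover have "region d ?L = region d X" using L(1) by (simp add: ideal_for_def)
    then have "u \<in> monomials ?L \<longleftrightarrow> u \<in> monomials X" if "mdeg u < d" "d \<le> mdeg u + 2" for u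
      using that by (simp add: in_monomials_iff_region)
    ultimately show "m \<in> core d (monomials X)"
      by (auto simp: core_def up_closed_def)
  next
    assume core: "m \<in> core d (monomials X)"
    let ?M = "{k \<in> core d (monomials X). mdeg k < d}"
    have M: "u \<in> gen ?M \<longleftrightarrow> u \<in> core d (monomials X)" if "mdeg u < d" for u
      using that up_closed_core mdvd_mdeg_le
      by (fastforce simp: gen_def multiples_def up_closed_def)
    have "ups d (- gen ?M) = ups d (- core d (monomials X))"
      "downs d (- gen ?M) = downs d (- core d (monomials X))"
      using M by (auto simp: ups_def downs_def)
    then have "region d (mon_span ?M :: 'k poly3 set) = region d X"
      by (simp add: region_monomials[of d "mon_span ?M"] monomials_mon_span region_core[OF X])
    then have "ideal_for d (region d X) (mon_span ?M :: 'k poly3 set)"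
      unfolding ideal_for_def by (intro conjI exI[of _ ?M]) auto
    then have "monomials (mon_span ?M :: 'k poly3 set) \<subseteq> monomials ?L"
      using L(2) by (auto simp: monomials_def)
    then show "m \<in> monomials ?L" using M[OF m] core by (auto simp: monomials_mon_span)
  qed
qed

lemma region_coeff_eq_side_sum:
  fixes X :: "'k::field poly3 set"
  assumes X: "up_closed (monomials X)" and d: "d \<ge> 1"
  shows "region_coeff TYPE('k) d (region d X) = side_sum d (core d (monomials X)) - int d"
proof -
  let ?L = "largest_ideal d (region d X) :: 'k poly3 set"
  have "{g \<in> min_gens ?L. mdeg g < d} = punctures d (monomials ?L)"
    by (auto simp: min_gens_def punctures_def monomials_def)
  also have "\<dots> = punctures d (core d (monomials X))"
    by (intro punctures_cong monomials_largest_ideal X d)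
  finally have "ideal_coeff d ?L = (\<Sum>g\<in>punctures d (core d (monomials X)). int d - int (mdeg g)) - int d"
    by (simp add: ideal_coeff_def)
  also have "(\<Sum>g\<in>punctures d (core d (monomials X)). int d - int (mdeg g)) = side_sum d (core d (monomials X))"
    unfolding side_sum_def by (intro sum.cong) (auto simp: punctures_def)
  finally show ?thesis by (simp add: region_coeff_def)
qed

theorem corollary2p4:
  fixes I :: "'k::field poly3 set" and d :: nat
  assumes "monomial_ideal I" and "d \<ge> 1"
  shows "(perfectly_punctured TYPE('k) d (region d I) \<and>
            (\<forall>n. mdeg n < d \<longrightarrow> \<not> over_punctured_subregion d I n) \<longrightarrow>
          tileable (region d I))
       \<and> (perfectly_punctured TYPE('k) d (region d I) \<and> tileable (region d I) \<longrightarrow>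
          (\<forall>n. mdeg n < d \<longrightarrow> \<not> over_punctured_subregion d I n))
       \<and> ((\<forall>n. mdeg n < d \<longrightarrow> \<not> over_punctured_subregion d I n) \<and> tileable (region d I) \<longrightarrow>
          perfectly_punctured TYPE('k) d (region d I))"
proof -
  let ?A = "core d (monomials I)"
  have S: "up_closed (monomials I)" using assms(1) by (rule up_closed_monomials)
  have "perfectly_punctured TYPE('k) d (region d I) \<longleftrightarrow> side_sum d ?A = int d"
    using region_coeff_eq_side_sum[OF S assms(2)] by (simp add: perfectly_punctured_def)
  moreover have "over_punctured_subregion d I n \<longleftrightarrow>
      \<not> side_sum (d - mdeg n) (quot ?A n) \<le> int (d - mdeg n)" if n: "mdeg n < d" for n
  proof -
    have "up_closed (monomials (colon I n))" using S by (simp add: monomials_colon up_closed_quot)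
    from region_coeff_eq_side_sum[OF this, of "d - mdeg n"] n show ?thesis
      by (auto simp: over_punctured_subregion_def over_punctured_def monomials_colon quot_core)
  qed
  ultimately show ?thesis
    using any_two_conditions_imply_third[of ?A d, OF up_closed_core]
      region_core[OF S, of d] assms(2)
    by (simp add: no_over_punctured_def)
qed

end
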